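(* For $n, m \in \mathbb{N}$, let $kr^b_{1-1}(n,m)$ be the number of partitions $\lambda_1 \le \lambda_2 \le \cdots \le \lambda_m$ of $n$ into $m$ parts with at most one occurrence of the part $2$, and with difference at least three at distance two, such that if two successive parts differ by at most one, then their sum is $\equiv 1 \pmod{3}$. Then $$\sum_{n, m \geq 0} kr^b_{1-1}(n, m)\, q^n x^m = \sum_{\substack{n_1 \geq 0 \\ n_2 \geq 1}} \frac{ q^{3n_2^2 + 4n_2 + n_1^2 + n_1 + 3n_1n_2}\, x^{2n_2 + n_1} }{ (q; q)_{n_1} (q^3; q^3)_{n_2} } + \sum_{\substack{n_1 \geq 0 \\ n_2 \geq 1}} \frac{ q^{3n_2^2 + 4n_2 + (n_1+1)^2 + 3n_1n_2}\, x^{2n_2 + n_1+1} }{ (q; q)_{n_1} (q^3; q^3)_{n_2} } + \sum_{n_1 \geq 0} \frac{ q^{n_1^2}\, x^{n_1} }{ (q; q)_{n_1} }.$$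
   Context: $\mathbb{N}=\{0,1,2,\dots\}$. A partition of $n$ into $m$ parts is a non-decreasing sequence $\lambda_1 \le \cdots \le \lambda_m$ of positive integers with sum $n$ (the empty partition is the unique partition of $0$, with $m=0$; it satisfies all the conditions vacuously). "Difference at least $k$ at distance $d$" means $\lambda_{j+d}-\lambda_j \ge k$ for all $1 \le j \le m-d$. "Successive parts" are $\lambda_j$ and $\lambda_{j+1}$. The $q$-Pochhammer symbol is $(a;q)_n = \prod_{j=1}^{n}(1-aq^{j-1})$, with $(a;q)_0=1$. The identity is one of formal power series in $q$ and $x$. The superscript $b$ and subscript $1-1$ in $kr^b_{1-1}$ are merely labels. *)

theory Defs
  imports
    "HOL-Analysis.Infinite_Sum"
    "HOL-Computational_Algebra.Formal_Power_Series"
begin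

definition is_partition :: "nat \<Rightarrow> nat \<Rightarrow> nat list \<Rightarrow> bool" where
  "is_partition n m xs \<longleftrightarrow>
     sorted xs \<and> (\<forall>y \<in> set xs. 0 < y) \<and> sum_list xs = n \<and> length xs = m"

definition diff_at_dist :: "nat \<Rightarrow> nat \<Rightarrow> nat list \<Rightarrow> bool" where
  "diff_at_dist k d xs \<longleftrightarrow> (\<forall>j. j + d < length xs \<longrightarrow> xs ! j + k \<le> xs ! (j + d))"

text \<open>The natural-number subtraction below is exact, since parts are listed in
  non-decreasing order.\<close>

definition kr_partitions :: "nat \<Rightarrow> nat \<Rightarrow> nat list set" where
  "kr_partitions n m =
     {xs. is_partition n m xs \<and> count_list xs 2 \<le> 1 \<and> diff_at_dist 3 2 xs \<and>
          (\<forall>j. j + 1 < length xs \<longrightarrow> xs ! (j + 1) - xs ! j \<le> 1 \<longrightarrow>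
               (xs ! j + xs ! (j + 1)) mod 3 = 1)}"

definition kr :: "nat \<Rightarrow> nat \<Rightarrow> nat" where
  "kr n m = card (kr_partitions n m)"

definition qpoch :: "'a::comm_ring_1 \<Rightarrow> 'a \<Rightarrow> nat \<Rightarrow> 'a" where
  "qpoch a q n = (\<Prod>j = 1..n. 1 - a * q ^ (j - 1))"

text \<open>Power series in \<open>q\<close> and \<open>x\<close> are power series in \<open>q\<close> whose coefficients are power
  series in \<open>x\<close>. The topology on \<^typ>\<open>rat fps fps\<close> is the \<open>q\<close>-adic one; all sums
  in question converge in it, by the lemmas below, so that none of
  the \<^const>\<open>infsum\<close> values is the default value for divergent sums.\<close>

definition qv :: "rat fps fps" where "qv = fps_X"
definition xv :: "rat fps fps" where "xv = fps_const fps_X"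

lemma qv_power_mult_nth: "fps_nth (qv ^ e * g) n = (if n < e then 0 else fps_nth g (n - e))"
  by (simp add: qv_def fps_X_power_mult_nth)

lemma summable_on_qv_power:
  assumes "\<And>n. finite {i \<in> A. e i \<le> n}"
  shows "(\<lambda>i. qv ^ e i * g i) summable_on A"
  unfolding summable_on_def
proof (intro exI has_sum_fpsI)
  fix n
  show "finite {i \<in> A. fps_nth (qv ^ e i * g i) n \<noteq> 0}"
    by (rule finite_subset[OF _ assms[of n]]) (auto simp: qv_power_mult_nth split: if_splits)
  show "fps_nth (Abs_fps (\<lambda>n. \<Sum>i | i \<in> A \<and> fps_nth (qv ^ e i * g i) n \<noteq> 0.
            fps_nth (qv ^ e i * g i) n)) n =
        (\<Sum>i | i \<in> A \<and> fps_nth (qv ^ e i * g i) n \<noteq> 0. fps_nth (qv ^ e i * g i) n)"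
    by simp
qed

lemma qpoch_qv_nth_0: "0 < k \<Longrightarrow> fps_nth (qpoch (qv ^ k) (qv ^ k) n) 0 = 1"
  unfolding qpoch_def
  by (induction n) (auto simp: qv_def fps_mult_nth_0 fps_power_zeroth)

lemma denominator_nth_0: "fps_nth (qpoch qv qv n1 * qpoch (qv^3) (qv^3) n2) 0 = 1"
  using qpoch_qv_nth_0[of 1 n1] qpoch_qv_nth_0[of 3 n2] by (simp add: fps_mult_nth_0)

text \<open>\<^typ>\<open>rat fps fps\<close> is not a field, but the quotients below are genuine ones.\<close>

lemma fps_divide_mult_cancel:
  fixes f g :: "rat fps fps"
  assumes "fps_nth g 0 = 1"
  shows "f / g = f * inverse g" and "f / g * g = f"
proof -
  show *: "f / g = f * inverse g" using assms by (intro fps_divide_unit) simp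
  have "inverse (fps_nth g 0) = 1" by (simp add: assms fps_inverse_one)
  hence "inverse g = fps_right_inverse g 1"
    by (simp only: fps_inverse_def[of g])
  moreover have "fps_right_inverse g 1 * g = 1"
    using fps_left_inverse_eq_fps_right_inverse[of 1 g 1] fps_left_inverse[of 1 g] assms by simp
  ultimately have "inverse g * g = 1" by simp
  thus "f / g * g = f" by (simp add: * mult.assoc)
qed

lemma kr_eq_0: "n < m \<Longrightarrow> kr n m = 0"
proof -
  have "length xs \<le> sum_list xs" if "\<forall>y \<in> set xs. 0 < y" for xs :: "nat list"
    using that by (induction xs) auto
  moreover assume "n < m"
  ultimately have "kr_partitions n m = {}"
    unfolding kr_partitions_def is_partition_def by fastforce
  thus ?thesis by (simp add: kr_def)
qed

lemma finite_kr_partitions: "finite (kr_partitions n m)"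
proof (rule finite_subset)
  show "kr_partitions n m \<subseteq> {xs. set xs \<subseteq> {..n} \<and> length xs = m}"
    unfolding kr_partitions_def is_partition_def using member_le_sum_list by fastforce
qed (simp add: finite_lists_length_eq)

lemma xv_power: "xv ^ m = fps_const (fps_X ^ m)"
  by (simp add: xv_def fps_const_power)

lemma kr_series_nth:
  "fps_nth (of_nat (kr n m) * qv ^ n * xv ^ m) k = (if k = n then of_nat (kr n m) * fps_X ^ m else 0)"
  by (simp add: mult.commute[of _ "qv ^ n"] mult.assoc qv_power_mult_nth xv_power
                fps_of_nat[symmetric] fps_const_mult[symmetric] del: fps_const_mult)

lemma kr_has_sum:
  "((\<lambda>(n, m). of_nat (kr n m) * qv ^ n * xv ^ m) has_sum
      Abs_fps (\<lambda>n. Abs_fps (\<lambda>m. of_nat (kr n m)))) UNIV"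
proof (rule has_sum_fpsI)
  fix k
  let ?B = "{z \<in> UNIV. fps_nth (case z of (n, m) \<Rightarrow> of_nat (kr n m) * qv ^ n * xv ^ m) k \<noteq> 0}"
  have sub: "?B \<subseteq> {k} \<times> {..k}"
    using kr_eq_0 by (fastforce simp: kr_series_nth split: if_splits intro: leI)
  show "finite ?B" by (rule finite_subset[OF sub]) simp
  have "(\<Sum>z\<in>?B. fps_nth (case z of (n, m) \<Rightarrow> of_nat (kr n m) * qv ^ n * xv ^ m) k) =
        (\<Sum>z\<in>{k} \<times> {..k}. fps_nth (case z of (n, m) \<Rightarrow> of_nat (kr n m) * qv ^ n * xv ^ m) k)"
    by (rule sum.mono_neutral_left) (use sub in auto)
  also have "\<dots> = (\<Sum>m\<le>k. of_nat (kr k m) * fps_X ^ m)"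
  proof -
    have "{k} \<times> {..k} = Pair k ` {..k}" by auto
    thus ?thesis by (simp add: sum.reindex inj_on_def kr_series_nth)
  qed
  also have "\<dots> = Abs_fps (\<lambda>m. of_nat (kr k m))"
  proof (rule fps_ext)
    fix j
    have "fps_nth (\<Sum>m\<le>k. of_nat (kr k m) * fps_X ^ m :: rat fps) j =
          (\<Sum>m\<le>k. if j = m then of_nat (kr k m) else 0)"
      unfolding fps_sum_nth
      by (intro sum.cong) (auto simp: fps_of_nat[symmetric] fps_X_power_nth)
    also have "\<dots> = of_nat (kr k j)"
      using kr_eq_0[of k j] by (auto simp: sum.delta')
    finally show "fps_nth (\<Sum>m\<le>k. of_nat (kr k m) * fps_X ^ m :: rat fps) j =
          fps_nth (Abs_fps (\<lambda>m. of_nat (kr k m))) j"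
      by simp
  qed
  finally show "fps_nth (Abs_fps (\<lambda>n. Abs_fps (\<lambda>m. of_nat (kr n m)))) k =
      (\<Sum>z\<in>?B. fps_nth (case z of (n, m) \<Rightarrow> of_nat (kr n m) * qv ^ n * xv ^ m) k)"
    by simp
qed

lemma double_series_summable:
  fixes e :: "nat \<Rightarrow> nat \<Rightarrow> nat"
  assumes "\<And>n1 n2. n1 \<le> e n1 n2 \<and> n2 \<le> e n1 n2"
  shows "(\<lambda>(n1, n2). qv ^ e n1 n2 * xv ^ d n1 n2
            / (qpoch qv qv n1 * qpoch (qv^3) (qv^3) n2)) summable_on A"
proof -
  have "finite {i \<in> A. e (fst i) (snd i) \<le> n}" for n
  proof (rule finite_subset)
    show "{i \<in> A. e (fst i) (snd i) \<le> n} \<subseteq> {..n} \<times> {..n}"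
      by (auto intro: order_trans[OF conjunct1[OF assms]] order_trans[OF conjunct2[OF assms]])
  qed simp
  from summable_on_qv_power[where e = "\<lambda>i. e (fst i) (snd i)", OF this]
  show ?thesis
    by (simp add: case_prod_unfold fps_divide_mult_cancel(1)[OF denominator_nth_0] mult.assoc)
qed

lemma first_series_summable:
  "(\<lambda>(n1, n2). qv ^ (3 * n2^2 + 4 * n2 + n1^2 + n1 + 3 * n1 * n2) * xv ^ (2 * n2 + n1)
      / (qpoch qv qv n1 * qpoch (qv^3) (qv^3) n2)) summable_on A"
  by (rule double_series_summable) auto

lemma second_series_summable:
  "(\<lambda>(n1, n2). qv ^ (3 * n2^2 + 4 * n2 + (n1 + 1)^2 + 3 * n1 * n2) * xv ^ (2 * n2 + n1 + 1)
      / (qpoch qv qv n1 * qpoch (qv^3) (qv^3) n2)) summable_on A"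
  by (rule double_series_summable) (auto simp: power2_eq_square)

lemma third_series_summable:
  "(\<lambda>n1. qv ^ (n1^2) * xv ^ n1 / qpoch qv qv n1) summable_on A"
proof -
  have "finite {i \<in> A. i^2 \<le> n}" for n :: nat
  proof (rule finite_subset)
    show "{i \<in> A. i^2 \<le> n} \<subseteq> {..n}"
      by (auto simp: power2_eq_square intro: order_trans[OF le_square])
  qed simp
  from summable_on_qv_power[where e = "\<lambda>i. i^2", OF this]
  show ?thesis
    using qpoch_qv_nth_0[of 1] by (simp add: fps_divide_mult_cancel(1) mult.assoc)
qed

end

theory Submission
  imports Defs
begin

text \<open>
  Both sides are read off from one system of \<open>q\<close>-difference equations. Let \<open>C\<^sub>i\<close> be the generating
  function of the partitions that satisfy the two difference conditions (but not necessarily the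
  condition on the part \<open>2\<close>) and have all parts at least \<open>i\<close>. A pair of successive parts that differ
  by at most one is \<open>(a, a)\<close> with \<open>a \<equiv> 2\<close> or \<open>(a, a + 1)\<close> with \<open>a \<equiv> 0\<close> modulo \<open>3\<close>. Splitting off the parts
  that are close to \<open>i\<close> therefore gives, according to \<open>i mod 3\<close>,
  \<^item> \<open>C\<^sub>i = C\<^sub>i\<^sub>+\<^sub>1 + x q\<^sup>i C\<^sub>i\<^sub>+\<^sub>2\<close> for \<open>i \<equiv> 1\<close>,
  \<^item> \<open>C\<^sub>i = C\<^sub>i\<^sub>+\<^sub>1 + x q\<^sup>i (C\<^sub>i\<^sub>+\<^sub>2 + x q\<^sup>i C\<^sub>i\<^sub>+\<^sub>3)\<close> for \<open>i \<equiv> 2\<close>, the last term coming from a repeated \<open>i\<close>,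
  \<^item> \<open>C\<^sub>i = C\<^sub>i\<^sub>+\<^sub>1 + x q\<^sup>i (C\<^sub>i\<^sub>+\<^sub>3 + x q\<^sup>i\<^sup>+\<^sup>2 C\<^sub>i\<^sub>+\<^sub>4 + x q\<^sup>i\<^sup>+\<^sup>1 C\<^sub>i\<^sub>+\<^sub>3)\<close> for \<open>i \<equiv> 0\<close>.

  On the analytic side consider the double series, summed over \<open>n\<^sub>1\<close> and \<open>n\<^sub>2\<close>,
  \<open>T(a, b) = \<Sum> q^(n\<^sub>1\<^sup>2 + 3 n\<^sub>1 n\<^sub>2 + 3 n\<^sub>2\<^sup>2 + a n\<^sub>1 + b n\<^sub>2) x^(n\<^sub>1 + 2 n\<^sub>2) / ((q; q)\<^bsub>n1\<^esub> (q\<^sup>3; q\<^sup>3)\<^bsub>n2\<^esub>)\<close>.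
  Cancelling the last factor of either Pochhammer symbol yields the two contiguous relations
  \<open>T(a, b) - T(a + 1, b) = x q\<^sup>a\<^sup>+\<^sup>1 T(a + 2, b + 3)\<close> and
  \<open>T(a, b) - T(a, b + 3) = x\<^sup>2 q\<^sup>b\<^sup>+\<^sup>3 T(a + 3, b + 6)\<close>
  (\<open>dseries_shift_left\<close> and \<open>dseries_shift_right\<close>). They imply that \<open>T(i - 1, b\<^sub>i)\<close>, with \<open>b\<^sub>i\<close> equal to
  \<open>2i - 1\<close>, \<open>2i - 3\<close> or \<open>2i - 2\<close> for \<open>i\<close> congruent to \<open>1\<close>, \<open>2\<close> or \<open>0\<close>, obeys the same recursion as \<open>C\<^sub>i\<close>
  (\<open>dseries_family_recursion\<close> and \<open>gf_kr_lists_recursion\<close>). The recursion determines the family,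
  because its members are \<open>1\<close> up to terms of \<open>q\<close>-order at least \<open>i\<close> (\<open>kr_recursion_unique\<close>).
  Hence \<open>C\<^sub>3 = T(2, 4)\<close> and \<open>C\<^sub>4 = T(3, 7)\<close>.

  A partition with at most one \<open>2\<close> has smallest part at least \<open>3\<close>, or equal to \<open>1\<close> and followed by parts
  that are at least \<open>3\<close>, or equal to \<open>2\<close> and followed by parts that are at least \<open>4\<close>. So the left-hand
  side is \<open>C\<^sub>3 + x q C\<^sub>3 + x q\<^sup>2 C\<^sub>4\<close>, which the first relation contracts to \<open>T(1, 4) + x q T(2, 4)\<close>.
  The terms of these two series with \<open>n\<^sub>2 \<ge> 1\<close> are the two double sums of the identity. Those with
  \<open>n\<^sub>2 = 0\<close> combine, by the first relation again, to the single sum.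
\<close>

section \<open>Infinite sums of formal power series\<close>

text \<open>A coefficient of a sum or product depends on finitely many coefficients of the operands, and a
  neighbourhood fixes finitely many coefficients. With these instances the general laws for infinite
  sums (additivity, disjoint unions, constant factors) apply to formal power series.\<close>

instance fps :: (ab_group_add) topological_comm_monoid_add
proof
  fix a b :: "'a fps"
  show "LIM x (nhds a \<times>\<^sub>F nhds b). fst x + snd x :> nhds (a + b)"
    unfolding tendsto_fps_iff
  proof
    fix n
    have "\<forall>\<^sub>F x in nhds a. fps_nth x n = fps_nth a n" "\<forall>\<^sub>F x in nhds b. fps_nth x n = fps_nth b n"
      using filterlim_ident[of "nhds a"] filterlim_ident[of "nhds b"] unfolding tendsto_fps_iff by auto
    from eventually_prodI[OF this]
    show "\<forall>\<^sub>F x in nhds a \<times>\<^sub>F nhds b. fps_nth (fst x + snd x) n = fps_nth (a + b) n"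
      by eventually_elim auto
  qed
qed

instance fps :: (ring) topological_semigroup_mult
proof
  fix a b :: "'a fps"
  show "LIM x (nhds a \<times>\<^sub>F nhds b). fst x * snd x :> nhds (a * b)"
    unfolding tendsto_fps_iff
  proof
    fix n
    have "\<forall>\<^sub>F x in nhds c. \<forall>k\<in>{..n}. fps_nth x k = fps_nth c k" for c :: "'a fps"
      using filterlim_ident[of "nhds c"] unfolding tendsto_fps_iff
      by (intro eventually_ball_finite) auto
    from eventually_prodI[OF this[of a] this[of b]]
    show "\<forall>\<^sub>F x in nhds a \<times>\<^sub>F nhds b. fps_nth (fst x * snd x) n = fps_nth (a * b) n"
      by eventually_elim (auto simp: fps_mult_nth intro!: sum.cong)
  qed
qed

lemma fps_nth_infsum_single:
  fixes f :: "'a \<Rightarrow> 'b :: ab_group_add fps"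
  assumes "f summable_on A" "z \<in> A" "\<And>y. y \<in> A \<Longrightarrow> y \<noteq> z \<Longrightarrow> fps_nth (f y) n = 0"
  shows "fps_nth (infsum f A) n = fps_nth (f z) n"
proof -
  have "fps_nth (infsum f A) n = (\<Sum>y | y \<in> A \<and> fps_nth (f y) n \<noteq> 0. fps_nth (f y) n)"
    by (rule has_sum_fpsD(2)[OF has_sum_infsum[OF assms(1)]])
  also have "\<dots> = (\<Sum>y\<in>{z}. fps_nth (f y) n)"
    using assms by (intro sum.mono_neutral_left) auto
  finally show ?thesis by simp
qed

section \<open>The double series\<close>

definition dterm :: "nat \<Rightarrow> nat \<Rightarrow> nat \<Rightarrow> nat \<Rightarrow> rat fps fps" where
  "dterm a b n1 n2 = qv ^ (n1^2 + 3 * n1 * n2 + 3 * n2^2 + a * n1 + b * n2) * xv ^ (n1 + 2 * n2)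
     / (qpoch qv qv n1 * qpoch (qv^3) (qv^3) n2)"

text \<open>The series \<open>T(a, b)\<close> is the case \<open>B = UNIV\<close>. The range of \<open>n\<^sub>2\<close> is a parameter since
  the identity separates the row \<open>n\<^sub>2 = 0\<close> from the others, and the relation that shifts
  \<open>n\<^sub>1\<close> holds in each row.\<close>

definition dseries :: "nat set \<Rightarrow> nat \<Rightarrow> nat \<Rightarrow> rat fps fps" where
  "dseries B a b = (\<Sum>\<^sub>\<infinity>(n1, n2)\<in>UNIV \<times> B. dterm a b n1 n2)"

lemma dterm_summable: "(\<lambda>(n1, n2). dterm a b n1 n2) summable_on A"
proof -
  have "n1 \<le> n1^2 + 3 * n1 * n2 + 3 * n2^2 + a * n1 + b * n2
      \<and> n2 \<le> n1^2 + 3 * n1 * n2 + 3 * n2^2 + a * n1 + b * n2" for n1 n2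
    using le_square[of n1] le_square[of n2] unfolding power2_eq_square by linarith
  thus ?thesis
    unfolding dterm_def by (rule double_series_summable)
qed

lemma qpoch_self_Suc: "qpoch q q (Suc n) = qpoch q q n * (1 - q ^ Suc n)"
  by (simp add: qpoch_def)

lemma dterm_mult_denominator:
  "dterm a b n1 n2 * (qpoch qv qv n1 * qpoch (qv^3) (qv^3) n2)
     = qv ^ (n1^2 + 3 * n1 * n2 + 3 * n2^2 + a * n1 + b * n2) * xv ^ (n1 + 2 * n2)"
  unfolding dterm_def by (rule fps_divide_mult_cancel(2)[OF denominator_nth_0])

lemma denominator_nonzero: "qpoch qv qv n1 * qpoch (qv^3) (qv^3) n2 \<noteq> 0"
proof
  assume "qpoch qv qv n1 * qpoch (qv^3) (qv^3) n2 = 0"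
  with denominator_nth_0[of n1 n2] show False by simp
qed

text \<open>The difference of the two terms with parameters \<open>a\<close> and \<open>a + 1\<close> carries the factor \<open>1 - q\<^bsup>n1+1\<^esup>\<close>,
  which is the last factor of the Pochhammer symbol \<open>(q; q)\<^bsub>n1+1\<^esub>\<close> in the denominator. After the
  cancellation the exponents are those of \<open>T(a + 2, b + 3)\<close>.\<close>

lemma dterm_Suc_left:
  "dterm a b (Suc n1) n2 = dterm (a + 1) b (Suc n1) n2 + qv ^ (a + 1) * xv * dterm (a + 2) (b + 3) n1 n2"
proof -
  let ?D = "qpoch qv qv n1 * qpoch (qv^3) (qv^3) n2"
  let ?D' = "qpoch qv qv (Suc n1) * qpoch (qv^3) (qv^3) n2"
  let ?u = "qv ^ Suc n1"
  let ?e = "n1^2 + 3 * n1 * n2 + 3 * n2^2 + (a + 2) * n1 + (b + 3) * n2"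
  have D': "?D' = ?D * (1 - ?u)" by (simp only: qpoch_self_Suc mult_ac)
  have e: "(Suc n1)^2 + 3 * Suc n1 * n2 + 3 * n2^2 + a * Suc n1 + b * n2 = (a + 1) + ?e"
    "(Suc n1)^2 + 3 * Suc n1 * n2 + 3 * n2^2 + (a + 1) * Suc n1 + b * n2 = (a + 1) + ?e + Suc n1"
    "Suc n1 + 2 * n2 = 1 + (n1 + 2 * n2)"
    by (simp_all add: algebra_simps power2_eq_square)
  have "(dterm (a + 1) b (Suc n1) n2 + qv ^ (a + 1) * xv * dterm (a + 2) (b + 3) n1 n2) * ?D'
      = dterm (a + 1) b (Suc n1) n2 * ?D' + qv ^ (a + 1) * xv * (dterm (a + 2) (b + 3) n1 n2 * ?D) * (1 - ?u)"
    unfolding D' by (simp only: algebra_simps)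
  also have "\<dots> = dterm a b (Suc n1) n2 * ?D'"
    unfolding dterm_mult_denominator e power_add[of qv "a + 1"] power_add[of qv _ "Suc n1"]
      power_add[of xv 1] power_one_right
    by (simp only: algebra_simps mult_1_left)
  finally show ?thesis
    using denominator_nonzero[of "Suc n1" n2] by (metis mult_right_cancel)
qed

text \<open>The same cancellation for \<open>n\<^sub>2\<close>. Here \<open>b\<close> has to grow by \<open>3\<close>, as the base of the Pochhammer symbol
  is \<open>q\<^sup>3\<close>.\<close>

lemma dterm_Suc_right:
  "dterm a b n1 (Suc n2) = dterm a (b + 3) n1 (Suc n2) + qv ^ (b + 3) * xv ^ 2 * dterm (a + 3) (b + 6) n1 n2"
proof -
  let ?D = "qpoch qv qv n1 * qpoch (qv^3) (qv^3) n2"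
  let ?D' = "qpoch qv qv n1 * qpoch (qv^3) (qv^3) (Suc n2)"
  let ?u = "qv ^ (3 * Suc n2)"
  let ?e = "n1^2 + 3 * n1 * n2 + 3 * n2^2 + (a + 3) * n1 + (b + 6) * n2"
  have D': "?D' = ?D * (1 - ?u)" by (simp only: qpoch_self_Suc power_mult mult.assoc)
  have e: "n1^2 + 3 * n1 * Suc n2 + 3 * (Suc n2)^2 + a * n1 + b * Suc n2 = (b + 3) + ?e"
    "n1^2 + 3 * n1 * Suc n2 + 3 * (Suc n2)^2 + a * n1 + (b + 3) * Suc n2 = (b + 3) + ?e + 3 * Suc n2"
    "n1 + 2 * Suc n2 = 2 + (n1 + 2 * n2)"
    by (simp_all add: algebra_simps power2_eq_square)
  have "(dterm a (b + 3) n1 (Suc n2) + qv ^ (b + 3) * xv ^ 2 * dterm (a + 3) (b + 6) n1 n2) * ?D'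
      = dterm a (b + 3) n1 (Suc n2) * ?D' + qv ^ (b + 3) * xv ^ 2 * (dterm (a + 3) (b + 6) n1 n2 * ?D) * (1 - ?u)"
    unfolding D' by (simp only: algebra_simps)
  also have "\<dots> = dterm a b n1 (Suc n2) * ?D'"
    unfolding dterm_mult_denominator e power_add[of qv "b + 3"] power_add[of qv _ "3 * Suc n2"]
      power_add[of xv 2]
    by (simp only: algebra_simps mult_1_left)
  finally show ?thesis
    using denominator_nonzero[of n1 "Suc n2"] by (metis mult_right_cancel)
qed

lemma has_sum_dseries: "((\<lambda>(n1, n2). dterm a b n1 n2) has_sum dseries B a b) (UNIV \<times> B)"
  unfolding dseries_def by (rule has_sum_infsum[OF dterm_summable])

text \<open>A term-by-term relation that involves an index shift \<open>h\<close> can be summed, provided that the terms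
  outside the range of \<open>h\<close> agree.\<close>

lemma dseries_eqI:
  assumes h: "inj_on h (UNIV \<times> B)" "h ` (UNIV \<times> B) \<subseteq> UNIV \<times> B"
    and fixed: "\<And>n1 n2. n2 \<in> B \<Longrightarrow> (n1, n2) \<notin> h ` (UNIV \<times> B) \<Longrightarrow> dterm a b n1 n2 = dterm a' b' n1 n2"
    and shift: "\<And>n1 n2. n2 \<in> B \<Longrightarrow> (case h (n1, n2) of (k1, k2) \<Rightarrow> dterm a b k1 k2)
      = (case h (n1, n2) of (k1, k2) \<Rightarrow> dterm a' b' k1 k2) + c * dterm a'' b'' n1 n2"
  shows "dseries B a b = dseries B a' b' + c * dseries B a'' b''"
proof -
  define f where "f = (\<lambda>(n1, n2). dterm a b n1 n2 - dterm a' b' n1 n2)"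
  have "((\<lambda>z. c * (case z of (n1, n2) \<Rightarrow> dterm a'' b'' n1 n2)) has_sum (c * dseries B a'' b'')) (UNIV \<times> B)"
    by (intro has_sum_cmult_right has_sum_dseries)
  also have "?this \<longleftrightarrow> ((f \<circ> h) has_sum (c * dseries B a'' b'')) (UNIV \<times> B)"
    using shift by (intro has_sum_cong) (auto simp: f_def case_prod_unfold)
  also have "\<dots> \<longleftrightarrow> (f has_sum (c * dseries B a'' b'')) (h ` (UNIV \<times> B))"
    by (rule has_sum_reindex[OF h(1), symmetric])
  also have "\<dots> \<longleftrightarrow> (f has_sum (c * dseries B a'' b'')) (UNIV \<times> B)"
    by (rule has_sum_cong_neutral) (use h(2) fixed in \<open>auto simp: f_def\<close>)
  finally have "((\<lambda>z. (case z of (n1, n2) \<Rightarrow> dterm a' b' n1 n2) + f z) has_sum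
      (dseries B a' b' + c * dseries B a'' b'')) (UNIV \<times> B)"
    by (intro has_sum_add has_sum_dseries)
  thus ?thesis
    unfolding dseries_def[of B a b] by (intro infsumI) (simp add: f_def case_prod_unfold)
qed

lemma dseries_shift_left:
  "dseries B a b = dseries B (a + 1) b + qv ^ (a + 1) * xv * dseries B (a + 2) (b + 3)"
proof (rule dseries_eqI[where h = "\<lambda>(n1, n2). (Suc n1, n2)"])
  fix n1 n2 assume "n2 \<in> B" and *: "(n1, n2) \<notin> (\<lambda>(n1, n2). (Suc n1, n2)) ` (UNIV \<times> B)"
  have "n1 = 0"
  proof (cases n1)
    case (Suc k)
    have "(\<lambda>(n1, n2). (Suc n1, n2)) (k, n2) \<in> (\<lambda>(n1, n2). (Suc n1, n2)) ` (UNIV \<times> B)"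
      using \<open>n2 \<in> B\<close> by (intro imageI) auto
    with * Suc show ?thesis by simp
  qed
  thus "dterm a b n1 n2 = dterm (a + 1) b n1 n2" by (simp add: dterm_def)
next
  show "(case (case (n1, n2) of (n1, n2) \<Rightarrow> (Suc n1, n2)) of (k1, k2) \<Rightarrow> dterm a b k1 k2) =
       (case (case (n1, n2) of (n1, n2) \<Rightarrow> (Suc n1, n2)) of (k1, k2) \<Rightarrow> dterm (a + 1) b k1 k2) +
       qv ^ (a + 1) * xv * dterm (a + 2) (b + 3) n1 n2" for n1 n2
    using dterm_Suc_left[of a b n1 n2] by simp
qed (auto simp: inj_on_def)

lemma dseries_shift_right:
  "dseries UNIV a b = dseries UNIV a (b + 3) + qv ^ (b + 3) * xv ^ 2 * dseries UNIV (a + 3) (b + 6)"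
proof (rule dseries_eqI[where h = "\<lambda>(n1, n2). (n1, Suc n2)"])
  fix n1 n2 :: nat assume *: "(n1, n2) \<notin> (\<lambda>(n1, n2). (n1, Suc n2)) ` (UNIV \<times> UNIV)"
  have "n2 = 0"
  proof (cases n2)
    case (Suc k)
    have "(\<lambda>(n1, n2). (n1, Suc n2)) (n1, k) \<in> (\<lambda>(n1, n2). (n1, Suc n2)) ` (UNIV \<times> UNIV)"
      by (intro imageI) auto
    with * Suc show ?thesis by simp
  qed
  thus "dterm a b n1 n2 = dterm a (b + 3) n1 n2" by (simp add: dterm_def)
next
  show "(case (case (n1, n2) of (n1, n2) \<Rightarrow> (n1, Suc n2)) of (k1, k2) \<Rightarrow> dterm a b k1 k2) =
       (case (case (n1, n2) of (n1, n2) \<Rightarrow> (n1, Suc n2)) of (k1, k2) \<Rightarrow> dterm a (b + 3) k1 k2) +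
       qv ^ (b + 3) * xv ^ 2 * dterm (a + 3) (b + 6) n1 n2" for n1 n2
    using dterm_Suc_right[of a b n1 n2] by simp
qed (auto simp: inj_on_def)

text \<open>All exponents of \<open>q\<close> other than the one at \<open>(0, 0)\<close> are at least \<open>min (a + 1) (b + 3)\<close>.\<close>

lemma dseries_nth_low:
  assumes "n < a + 1" "n < b + 3"
  shows "fps_nth (dseries UNIV a b) n = fps_nth 1 n"
proof -
  have "fps_nth (dseries UNIV a b) n = fps_nth (case (0, 0) of (n1, n2) \<Rightarrow> dterm a b n1 n2) n"
    unfolding dseries_def
  proof (rule fps_nth_infsum_single[OF dterm_summable])
    fix y :: "nat \<times> nat" assume "y \<noteq> (0, 0)"
    obtain n1 n2 where y: "y = (n1, n2)" by (cases y)
    have "n < n1^2 + 3 * n1 * n2 + 3 * n2^2 + a * n1 + b * n2"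
    proof (cases "n1 = 0")
      case True
      with \<open>y \<noteq> (0, 0)\<close> y obtain k where "n2 = Suc k" by (cases n2) auto
      thus ?thesis using True assms by (simp add: power2_eq_square algebra_simps)
    next
      case False
      then obtain k where "n1 = Suc k" by (cases n1) auto
      thus ?thesis using assms by (simp add: power2_eq_square algebra_simps)
    qed
    thus "fps_nth (case y of (n1, n2) \<Rightarrow> dterm a b n1 n2) n = 0"
      by (simp add: y dterm_def fps_divide_mult_cancel(1)[OF denominator_nth_0] mult.assoc
          qv_power_mult_nth)
  qed auto
  also have "(case (0, 0) of (n1, n2) \<Rightarrow> dterm a b n1 n2) = 1"
    using fps_divide_mult_cancel(2)[of 1 1] by (simp add: dterm_def qpoch_def)
  finally show ?thesis .
qed

section \<open>A recursion with a unique solution\<close>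

text \<open>The system of equations that is common to the generating functions \<open>C\<^sub>i\<close> of partitions with all
  parts at least \<open>i\<close> and to the double series.\<close>

definition kr_recursion :: "(nat \<Rightarrow> rat fps fps) \<Rightarrow> bool" where
  "kr_recursion F \<longleftrightarrow> (\<forall>i\<ge>1. F i = F (i + 1) + qv ^ i * (xv *
     (if i mod 3 = 1 then F (i + 2)
      else if i mod 3 = 2 then F (i + 2) + qv ^ i * (xv * F (i + 3))
      else F (i + 3) + qv ^ (i + 2) * (xv * F (i + 4)) + qv ^ (i + 1) * (xv * F (i + 3)))))"

text \<open>Each step of the recursion either raises the index or, through the factor \<open>q\<^sup>i\<close>, also lowers the
  degree of the coefficient in question. So the excess of the degree over the index decreases until
  the degree is smaller than the index, where the solutions agree by assumption.\<close>

lemma kr_recursion_unique: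
  assumes F: "kr_recursion F" and G: "kr_recursion G"
    and low: "\<And>i n. n < i \<Longrightarrow> fps_nth (F i) n = fps_nth (G i) n"
    and "1 \<le> i"
  shows "F i = G i"
proof (rule fps_ext)
  fix n
  \<comment> \<open>Induction on a bound \<open>k\<close> for \<open>n - i\<close>; the case \<open>k = 0\<close> is the assumption on low degrees.\<close>
  have "\<forall>i\<ge>1. \<forall>n < i + k. fps_nth (F i) n = fps_nth (G i) n" for k
  proof (induction k)
    case 0
    show ?case using low by simp
  next
    case (Suc k)
    show ?case
    proof (intro allI impI)
      fix i n :: nat assume i: "1 \<le> i" and n: "n < i + Suc k"
      have IH: "fps_nth (F j) m = fps_nth (G j) m" if "i < j" "m \<le> n" for j m
        using Suc.IH that i n by auto
      have xv_nth: "fps_nth (xv * g) m = fps_X * fps_nth g m" for g m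
        by (simp add: xv_def)
      have Fi: "F i = F (i + 1) + qv ^ i * (xv *
          (if i mod 3 = 1 then F (i + 2)
           else if i mod 3 = 2 then F (i + 2) + qv ^ i * (xv * F (i + 3))
           else F (i + 3) + qv ^ (i + 2) * (xv * F (i + 4)) + qv ^ (i + 1) * (xv * F (i + 3))))"
        using F i unfolding kr_recursion_def by blast
      have Gi: "G i = G (i + 1) + qv ^ i * (xv *
          (if i mod 3 = 1 then G (i + 2)
           else if i mod 3 = 2 then G (i + 2) + qv ^ i * (xv * G (i + 3))
           else G (i + 3) + qv ^ (i + 2) * (xv * G (i + 4)) + qv ^ (i + 1) * (xv * G (i + 3))))"
        using G i unfolding kr_recursion_def by blast
      show "fps_nth (F i) n = fps_nth (G i) n"
        unfolding Fi Gi by (simp add: qv_power_mult_nth xv_nth IH del: power_Suc)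
    qed
  qed
  from this[of "Suc n"] \<open>1 \<le> i\<close> show "fps_nth (F i) n = fps_nth (G i) n" by auto
qed

text \<open>The first parameter is forced by the smallest possible part: the term at \<open>(1, 0)\<close> starts with
  \<open>x q\<^bsup>a+1\<^esup>\<close>. The second one is forced by the lightest pair of close parts: the term at \<open>(0, 1)\<close> has exponent \<open>b + 3\<close>, and
  the lightest pair of successive parts at least \<open>i\<close> that differ by at most one is \<open>(i + 1, i + 1)\<close>,
  \<open>(i, i)\<close> or \<open>(i, i + 1)\<close> for \<open>i\<close> congruent to \<open>1\<close>, \<open>2\<close> or \<open>0\<close>.\<close>

definition dseries_family :: "nat \<Rightarrow> rat fps fps" where
  "dseries_family i = dseries UNIV (i - 1)
     (if i mod 3 = 1 then 2 * i - 1 else if i mod 3 = 2 then 2 * i - 3 else 2 * i - 2)"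

lemma dseries_family_Suc:
  "Suc a mod 3 = 1 \<Longrightarrow> b = 2 * a + 1 \<Longrightarrow> dseries_family (Suc a) = dseries UNIV a b"
  "Suc a mod 3 = 2 \<Longrightarrow> b = 2 * a - 1 \<Longrightarrow> dseries_family (Suc a) = dseries UNIV a b"
  "Suc a mod 3 = 0 \<Longrightarrow> b = 2 * a \<Longrightarrow> dseries_family (Suc a) = dseries UNIV a b"
proof -
  have e: "Suc a - 1 = a" "2 * Suc a - 1 = 2 * a + 1" "2 * Suc a - 3 = 2 * a - 1" "2 * Suc a - 2 = 2 * a"
    by presburger+
  show "Suc a mod 3 = 1 \<Longrightarrow> b = 2 * a + 1 \<Longrightarrow> dseries_family (Suc a) = dseries UNIV a b"
    "Suc a mod 3 = 2 \<Longrightarrow> b = 2 * a - 1 \<Longrightarrow> dseries_family (Suc a) = dseries UNIV a b"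
    "Suc a mod 3 = 0 \<Longrightarrow> b = 2 * a \<Longrightarrow> dseries_family (Suc a) = dseries UNIV a b"
    unfolding dseries_family_def e by simp_all
qed

lemma dseries_family_recursion: "kr_recursion dseries_family"
  unfolding kr_recursion_def
proof (intro allI impI)
  fix i :: nat assume "1 \<le> i"
  then obtain a where a: "i = Suc a" by (cases i) auto
  have "i mod 3 = 1 \<or> i mod 3 = 2 \<or> i mod 3 = 0" by presburger
  thus "dseries_family i = dseries_family (i + 1) + qv ^ i * (xv *
     (if i mod 3 = 1 then dseries_family (i + 2)
      else if i mod 3 = 2 then dseries_family (i + 2) + qv ^ i * (xv * dseries_family (i + 3))
      else dseries_family (i + 3) + qv ^ (i + 2) * (xv * dseries_family (i + 4))
        + qv ^ (i + 1) * (xv * dseries_family (i + 3))))"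
  proof (elim disjE)
    assume i: "i mod 3 = 1"
    have "Suc (a + 1) mod 3 = 2" "Suc (a + 2) mod 3 = 0" using i unfolding a by presburger+
    hence F: "dseries_family i = dseries UNIV a (2 * a + 1)"
      "dseries_family (i + 1) = dseries UNIV (a + 1) (2 * a + 1)"
      "dseries_family (i + 2) = dseries UNIV (a + 2) (2 * a + 4)"
      using i dseries_family_Suc(1)[of a "2 * a + 1"] dseries_family_Suc(2)[of "a + 1" "2 * a + 1"]
        dseries_family_Suc(3)[of "a + 2" "2 * a + 4"] by (simp_all add: a)
    have "dseries UNIV a (2 * a + 1) = dseries UNIV (a + 1) (2 * a + 1)
        + qv ^ i * (xv * dseries UNIV (a + 2) (2 * a + 4))"
      using dseries_shift_left[of UNIV a "2 * a + 1"] by (simp add: a mult.assoc add.commute)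
    thus ?thesis unfolding F by (simp add: i)
  next
    assume i: "i mod 3 = 2"
    have "Suc (a + 1) mod 3 = 0" "Suc (a + 2) mod 3 = 1" "Suc (a + 3) mod 3 = 2" "1 \<le> a"
      using i unfolding a by presburger+
    hence F: "dseries_family i = dseries UNIV a (2 * a - 1)"
      "dseries_family (i + 1) = dseries UNIV (a + 1) (2 * a + 2)"
      "dseries_family (i + 2) = dseries UNIV (a + 2) (2 * a + 5)"
      "dseries_family (i + 3) = dseries UNIV (a + 3) (2 * a + 5)"
      using i dseries_family_Suc(2)[of a "2 * a - 1"] dseries_family_Suc(3)[of "a + 1" "2 * a + 2"]
        dseries_family_Suc(1)[of "a + 2" "2 * a + 5"] dseries_family_Suc(2)[of "a + 3" "2 * a + 5"] by (simp_all add: a)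
    have "dseries UNIV a (2 * a - 1) = dseries UNIV a (2 * a + 2)
        + qv ^ (2 * i) * (xv ^ 2 * dseries UNIV (a + 3) (2 * a + 5))"
      using dseries_shift_right[of a "2 * a - 1"] \<open>1 \<le> a\<close> by (simp add: a mult.assoc add.commute)
    also have "qv ^ (2 * i) = qv ^ i * qv ^ i" by (simp only: mult_2 power_add)
    also have "dseries UNIV a (2 * a + 2) = dseries UNIV (a + 1) (2 * a + 2)
        + qv ^ i * (xv * dseries UNIV (a + 2) (2 * a + 5))"
      using dseries_shift_left[of UNIV a "2 * a + 2"] by (simp add: a mult.assoc add.commute)
    finally show ?thesis
      unfolding F by (simp add: i power2_eq_square algebra_simps)
  next
    assume i: "i mod 3 = 0"
    have "Suc (a + 1) mod 3 = 1" "Suc (a + 3) mod 3 = 0" "Suc (a + 4) mod 3 = 1"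
      using i unfolding a by presburger+
    hence F: "dseries_family i = dseries UNIV a (2 * a)"
      "dseries_family (i + 1) = dseries UNIV (a + 1) (2 * a + 3)"
      "dseries_family (i + 3) = dseries UNIV (a + 3) (2 * a + 6)"
      "dseries_family (i + 4) = dseries UNIV (a + 4) (2 * a + 9)"
      using i dseries_family_Suc(3)[of a "2 * a"] dseries_family_Suc(1)[of "a + 1" "2 * a + 3"]
        dseries_family_Suc(3)[of "a + 3" "2 * a + 6"] dseries_family_Suc(1)[of "a + 4" "2 * a + 9"] by (simp_all add: a)
    have "dseries UNIV a (2 * a) = dseries UNIV a (2 * a + 3)
        + qv ^ (2 * a + 3) * (xv ^ 2 * dseries UNIV (a + 3) (2 * a + 6))"
      using dseries_shift_right[of a "2 * a"] by (simp add: a mult.assoc)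
    also have "qv ^ (2 * a + 3) = qv ^ i * qv ^ (i + 1)"
    proof -
      have "2 * a + 3 = i + (i + 1)" using a by simp
      thus ?thesis by (simp only: power_add)
    qed
    also have "dseries UNIV a (2 * a + 3) = dseries UNIV (a + 1) (2 * a + 3)
        + qv ^ i * (xv * dseries UNIV (a + 2) (2 * a + 6))"
      using dseries_shift_left[of UNIV a "2 * a + 3"] by (simp add: a mult.assoc add.commute)
    also have "dseries UNIV (a + 2) (2 * a + 6) = dseries UNIV (a + 3) (2 * a + 6)
        + qv ^ (i + 2) * (xv * dseries UNIV (a + 4) (2 * a + 9))"
      using dseries_shift_left[of UNIV "a + 2" "2 * a + 6"]
      by (simp add: a mult.assoc add.assoc add.commute[of 3 a] del: add_2_eq_Suc')
    finally show ?thesis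
      unfolding F by (simp add: i power2_eq_square algebra_simps)
  qed
qed

lemma dseries_family_nth_low: "n < i \<Longrightarrow> fps_nth (dseries_family i) n = fps_nth 1 n"
  unfolding dseries_family_def by (rule dseries_nth_low) auto

section \<open>Removing the smallest part of a partition\<close>

definition kr_differences :: "nat list \<Rightarrow> bool" where
  "kr_differences xs \<longleftrightarrow> sorted xs \<and> diff_at_dist 3 2 xs \<and>
     (\<forall>j. j + 1 < length xs \<longrightarrow> xs ! (j + 1) - xs ! j \<le> 1 \<longrightarrow> (xs ! j + xs ! (j + 1)) mod 3 = 1)"

definition kr_lists :: "nat \<Rightarrow> nat list set" where
  "kr_lists i = {xs. kr_differences xs \<and> (\<forall>y\<in>set xs. i \<le> y)}"

lemma all_nat_split: "(\<forall>j. P j) \<longleftrightarrow> P 0 \<and> (\<forall>j. P (Suc j))"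
  by (metis not0_implies_Suc)

text \<open>The congruence on the sum of two close parts is a condition on the smaller one.\<close>

lemma close_parts_iff:
  fixes a b :: nat
  assumes "a \<le> b"
  shows "(b - a \<le> 1 \<longrightarrow> (a + b) mod 3 = 1) \<longleftrightarrow> (b = a \<longrightarrow> a mod 3 = 2) \<and> (b = a + 1 \<longrightarrow> a mod 3 = 0)"
proof -
  have "(a + a) mod 3 = 1 \<longleftrightarrow> a mod 3 = 2" "(a + (a + 1)) mod 3 = 1 \<longleftrightarrow> a mod 3 = 0"
    by presburger+
  moreover have "b - a \<le> 1 \<longleftrightarrow> b = a \<or> b = a + 1" using assms by auto
  ultimately show ?thesis by auto
qed

lemma kr_differences_simps [simp]:
  "kr_differences []"
  "kr_differences [a]"
  "kr_differences [a, b] \<longleftrightarrow> a \<le> b \<and> (b = a \<longrightarrow> a mod 3 = 2) \<and> (b = a + 1 \<longrightarrow> a mod 3 = 0)"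
  "kr_differences (a # b # c # xs) \<longleftrightarrow> kr_differences [a, b] \<and> a + 3 \<le> c \<and> kr_differences (b # c # xs)"
proof -
  show "kr_differences []" "kr_differences [a]"
    by (auto simp: kr_differences_def diff_at_dist_def)
  have pair: "kr_differences [a, b] \<longleftrightarrow> a \<le> b \<and> (b - a \<le> 1 \<longrightarrow> (a + b) mod 3 = 1)"
    by (auto simp: kr_differences_def diff_at_dist_def)
  show "kr_differences [a, b] \<longleftrightarrow> a \<le> b \<and> (b = a \<longrightarrow> a mod 3 = 2) \<and> (b = a + 1 \<longrightarrow> a mod 3 = 0)"
    unfolding pair by (rule conj_cong[OF refl close_parts_iff])
  have 1: "diff_at_dist 3 2 (a # b # c # xs) \<longleftrightarrow> a + 3 \<le> c \<and> diff_at_dist 3 2 (b # c # xs)"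
    unfolding diff_at_dist_def by (subst all_nat_split) simp
  have 2: "(\<forall>j. j + 1 < length (a # b # c # xs) \<longrightarrow> (a # b # c # xs) ! (j + 1) - (a # b # c # xs) ! j \<le> 1
        \<longrightarrow> ((a # b # c # xs) ! j + (a # b # c # xs) ! (j + 1)) mod 3 = 1)
      \<longleftrightarrow> (b - a \<le> 1 \<longrightarrow> (a + b) mod 3 = 1) \<and>
      (\<forall>j. j + 1 < length (b # c # xs) \<longrightarrow> (b # c # xs) ! (j + 1) - (b # c # xs) ! j \<le> 1
        \<longrightarrow> ((b # c # xs) ! j + (b # c # xs) ! (j + 1)) mod 3 = 1)"
    by (subst all_nat_split) simp
  show "kr_differences (a # b # c # xs) \<longleftrightarrow> kr_differences [a, b] \<and> a + 3 \<le> c \<and> kr_differences (b # c # xs)"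
    unfolding pair unfolding kr_differences_def 1 2 by auto
qed

lemma kr_differences_first_two:
  "kr_differences (a # b # xs) \<Longrightarrow> a \<le> b \<and> (b = a \<longrightarrow> a mod 3 = 2)"
  by (cases xs) auto

lemma kr_differences_sorted: "kr_differences xs \<Longrightarrow> sorted xs"
  by (simp add: kr_differences_def)

lemma kr_lists_Nil [simp]: "[] \<in> kr_lists i"
  by (simp add: kr_lists_def)

lemma kr_lists_Cons:
  "a # xs \<in> kr_lists i \<longleftrightarrow> i \<le> a \<and> kr_differences (a # xs)"
  using kr_differences_sorted[of "a # xs"] by (auto simp: kr_lists_def intro: order_trans)

lemma kr_lists_smallest_part:
  "kr_lists i = kr_lists (i + 1) \<union> Cons i ` {ys. i # ys \<in> kr_lists i}"
proof (rule set_eqI)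
  fix xs
  show "xs \<in> kr_lists i \<longleftrightarrow> xs \<in> kr_lists (i + 1) \<union> Cons i ` {ys. i # ys \<in> kr_lists i}"
  proof (cases xs)
    case (Cons a ys)
    show ?thesis unfolding Cons by (cases "a = i") (auto simp: kr_lists_Cons)
  qed simp
qed

lemma list_cases_upto_3:
  obtains "xs = []" | b where "xs = [b]" | b c where "xs = [b, c]" | b c d ys where "xs = b # c # d # ys"
  by (metis neq_Nil_conv)

text \<open>For \<open>i \<equiv> 1\<close> the parts \<open>i\<close> and \<open>i + 1\<close> cannot follow \<open>i\<close>. The condition at distance two is then
  automatic: it could only fail for \<open>i, i + 2, i + 2\<close>, and \<open>i + 2 \<equiv> 0\<close> cannot be repeated.\<close>

lemma kr_lists_after_1_mod_3:
  assumes "i mod 3 = 1"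
  shows "{ys. i # ys \<in> kr_lists i} = kr_lists (i + 2)"
proof (rule set_eqI)
  fix ys
  have m: "(i + 1) mod 3 = 2" "(i + 2) mod 3 = 0" using assms by presburger+
  have "i # ys \<in> kr_lists i \<longleftrightarrow> ys \<in> kr_lists (i + 2)"
  proof (cases ys rule: list_cases_upto_3)
    case (2 b)
    consider "b < i" | "b = i" | "b = i + 1" | "b \<ge> i + 2" by linarith
    thus ?thesis by cases (use assms m in \<open>auto simp: 2 kr_lists_Cons\<close>)
  next
    case (3 b c)
    consider "b < i" | "b = i" | "b = i + 1" | "b = i + 2" | "b \<ge> i + 3" by linarith
    thus ?thesis by cases (use assms m in \<open>auto simp: 3 kr_lists_Cons\<close>)
  next
    case (4 b c d zs)
    consider "b < i" | "b = i" | "b = i + 1" | "b = i + 2" | "b \<ge> i + 3" by linarith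
    moreover have "kr_differences (c # d # zs) \<Longrightarrow> c \<le> d"
      using kr_differences_sorted[of "c # d # zs"] by simp
    ultimately show ?thesis by cases (use assms m in \<open>auto simp: 4 kr_lists_Cons\<close>)
  qed (simp add: kr_lists_Cons)
  thus "ys \<in> {ys. i # ys \<in> kr_lists i} \<longleftrightarrow> ys \<in> kr_lists (i + 2)" by simp
qed

text \<open>For \<open>i \<equiv> 2\<close> the part \<open>i\<close> may be repeated, and then the condition at distance two forces the other
  parts to be at least \<open>i + 3\<close>. A single \<open>i\<close> is followed by parts that are at least \<open>i + 2\<close>; as
  \<open>i + 2 \<equiv> 1\<close> cannot be repeated, the condition at distance two is automatic.\<close>

lemma kr_lists_after_2_mod_3:
  assumes "i mod 3 = 2"
  shows "{ys. i # ys \<in> kr_lists i} = kr_lists (i + 2) \<union> Cons i ` kr_lists (i + 3)"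
proof (rule set_eqI)
  fix ys
  have m: "(i + 1) mod 3 = 0" "(i + 2) mod 3 = 1" using assms by presburger+
  have "i # ys \<in> kr_lists i \<longleftrightarrow> ys \<in> kr_lists (i + 2) \<union> Cons i ` kr_lists (i + 3)"
  proof (cases ys rule: list_cases_upto_3)
    case (2 b)
    consider "b < i" | "b = i" | "b = i + 1" | "b \<ge> i + 2" by linarith
    thus ?thesis by cases (use assms m in \<open>auto simp: 2 kr_lists_Cons\<close>)
  next
    case (3 b c)
    consider "b < i" | "b = i" | "b = i + 1" | "b = i + 2" | "b \<ge> i + 3" by linarith
    thus ?thesis by cases (use assms m in \<open>auto simp: 3 kr_lists_Cons\<close>)
  next
    case (4 b c d zs)
    consider "b < i" | "b = i" | "b = i + 1" | "b = i + 2" | "b \<ge> i + 3" by linarith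
    moreover have "kr_differences (c # d # zs) \<Longrightarrow> c \<le> d"
      using kr_differences_sorted[of "c # d # zs"] by simp
    ultimately show ?thesis by cases (use assms m in \<open>auto simp: 4 kr_lists_Cons\<close>)
  qed (simp add: kr_lists_Cons)
  thus "ys \<in> {ys. i # ys \<in> kr_lists i} \<longleftrightarrow> ys \<in> kr_lists (i + 2) \<union> Cons i ` kr_lists (i + 3)" by simp
qed

text \<open>For \<open>i \<equiv> 0\<close> the part \<open>i\<close> may be followed by \<open>i + 1\<close>, and then by parts that are at least \<open>i + 3\<close>;
  the condition at distance two for \<open>i + 1\<close> holds since \<open>i + 3\<close> cannot be repeated. The part \<open>i + 2\<close> may
  be repeated in general but not after \<open>i\<close>, so it is split off separately. The
  parts after \<open>i + 2\<close> are then at least \<open>i + 4\<close>, because \<open>i + 3\<close> is too close to it, and the condition at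
  distance two for \<open>i + 2\<close> holds since \<open>i + 4\<close> cannot be repeated.\<close>

lemma kr_lists_after_0_mod_3:
  assumes "i mod 3 = 0"
  shows "{ys. i # ys \<in> kr_lists i} = kr_lists (i + 3) \<union> Cons (i + 2) ` kr_lists (i + 4)
    \<union> Cons (i + 1) ` kr_lists (i + 3)"
proof (rule set_eqI)
  fix ys
  have m: "(i + 1) mod 3 = 1" "(i + 2) mod 3 = 2" "(i + 3) mod 3 = 0" "(i + 4) mod 3 = 1" using assms by presburger+
  have "i # ys \<in> kr_lists i \<longleftrightarrow> ys \<in> kr_lists (i + 3) \<union> Cons (i + 2) ` kr_lists (i + 4)
    \<union> Cons (i + 1) ` kr_lists (i + 3)"
  proof (cases ys rule: list_cases_upto_3)
    case (2 b)
    consider "b < i" | "b = i" | "b = i + 1" | "b = i + 2" | "b \<ge> i + 3" by linarith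
    thus ?thesis by cases (use assms m in \<open>auto simp: 2 kr_lists_Cons\<close>)
  next
    case (3 b c)
    consider "b < i" | "b = i" | "b = i + 1" | "b = i + 2" | "b \<ge> i + 3" by linarith
    thus ?thesis by cases (use assms m in \<open>auto simp: 3 kr_lists_Cons\<close>)
  next
    case (4 b c d zs)
    consider "b < i" | "b = i" | "b = i + 1" | "b = i + 2" | "b \<ge> i + 3" by linarith
    moreover have "i + 4 \<le> d" if "kr_differences (c # d # zs)" "i + 3 \<le> c"
      using kr_differences_first_two[OF that(1)] that(2) assms by (cases "c = i + 3") auto
    moreover have "i + 5 \<le> d" if "kr_differences (c # d # zs)" "i + 4 \<le> c"
      using kr_differences_first_two[OF that(1)] that(2) m by (cases "c = i + 4") auto
    ultimately show ?thesis by cases (use assms m in \<open>auto simp: 4 kr_lists_Cons\<close>)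
  qed (simp add: kr_lists_Cons)
  thus "ys \<in> {ys. i # ys \<in> kr_lists i} \<longleftrightarrow> ys \<in> kr_lists (i + 3) \<union> Cons (i + 2) ` kr_lists (i + 4)
    \<union> Cons (i + 1) ` kr_lists (i + 3)" by simp
qed

section \<open>Generating functions of partitions\<close>

definition weight :: "nat list \<Rightarrow> rat fps fps" where
  "weight xs = qv ^ sum_list xs * xv ^ length xs"

definition positive_lists :: "nat list set" where
  "positive_lists = {xs. \<forall>y\<in>set xs. 0 < y}"

lemma length_le_sum_list: "xs \<in> positive_lists \<Longrightarrow> length xs \<le> sum_list xs"
  unfolding positive_lists_def by (induction xs) auto

lemma finite_sum_list_le:
  assumes "A \<subseteq> positive_lists"
  shows "finite {xs \<in> A. sum_list xs \<le> n}"
proof (rule finite_subset)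
  show "{xs \<in> A. sum_list xs \<le> n} \<subseteq> {xs. set xs \<subseteq> {..n} \<and> length xs \<le> n}"
    using assms length_le_sum_list by (fastforce dest: member_le_sum_list)
qed (simp add: finite_lists_length_le)

lemma weight_summable: "A \<subseteq> positive_lists \<Longrightarrow> weight summable_on A"
  unfolding weight_def by (intro summable_on_qv_power finite_sum_list_le)

definition gf :: "nat list set \<Rightarrow> rat fps fps" where
  "gf A = infsum weight A"

lemma gf_Un:
  assumes "A \<subseteq> positive_lists" "B \<subseteq> positive_lists" "A \<inter> B = {}"
  shows "gf (A \<union> B) = gf A + gf B"
  unfolding gf_def using assms by (intro infsum_Un_disjoint weight_summable)

lemma gf_Cons_image:
  assumes "A \<subseteq> positive_lists"
  shows "gf (Cons a ` A) = qv ^ a * (xv * gf A)"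
proof -
  have "gf (Cons a ` A) = infsum (weight \<circ> Cons a) A"
    unfolding gf_def by (rule infsum_reindex) simp
  also have "weight \<circ> Cons a = (\<lambda>xs. (qv ^ a * xv) * weight xs)"
    by (auto simp: weight_def power_add mult_ac)
  also have "infsum \<dots> A = qv ^ a * xv * gf A"
    unfolding gf_def by (rule infsum_cmult_right[OF weight_summable[OF assms]])
  finally show ?thesis by (simp add: mult.assoc)
qed

lemma Cons_image_positive:
  "0 < a \<Longrightarrow> A \<subseteq> positive_lists \<Longrightarrow> Cons a ` A \<subseteq> positive_lists"
  by (fastforce simp: positive_lists_def)

lemma kr_lists_positive: "1 \<le> i \<Longrightarrow> kr_lists i \<subseteq> positive_lists"
  by (auto simp: kr_lists_def positive_lists_def Suc_le_eq)

lemma kr_lists_Cons_disjoint: "a < i \<Longrightarrow> kr_lists i \<inter> Cons a ` A = {}"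
  by (auto simp: kr_lists_Cons)

lemma gf_kr_lists_recursion: "kr_recursion (\<lambda>i. gf (kr_lists i))"
  unfolding kr_recursion_def
proof (intro allI impI)
  fix i :: nat assume i1: "1 \<le> i"
  note pos = kr_lists_positive Cons_image_positive
  let ?R = "{ys. i # ys \<in> kr_lists i}"
  have "?R \<subseteq> positive_lists"
    using i1 by (fastforce simp: kr_lists_def positive_lists_def)
  hence "gf (kr_lists i) = gf (kr_lists (i + 1)) + qv ^ i * (xv * gf ?R)"
    using i1 by (subst kr_lists_smallest_part) (simp add: gf_Un gf_Cons_image pos kr_lists_Cons_disjoint)
  also have "gf ?R = (if i mod 3 = 1 then gf (kr_lists (i + 2))
      else if i mod 3 = 2 then gf (kr_lists (i + 2)) + qv ^ i * (xv * gf (kr_lists (i + 3)))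
      else gf (kr_lists (i + 3)) + qv ^ (i + 2) * (xv * gf (kr_lists (i + 4)))
        + qv ^ (i + 1) * (xv * gf (kr_lists (i + 3))))"
  proof -
    have "i mod 3 = 1 \<or> i mod 3 = 2 \<or> i mod 3 = 0" by presburger
    thus ?thesis
    proof (elim disjE)
      assume 1: "i mod 3 = 1"
      show ?thesis by (simp add: 1 kr_lists_after_1_mod_3)
    next
      assume 2: "i mod 3 = 2"
      have "gf (kr_lists (i + 2) \<union> Cons i ` kr_lists (i + 3))
          = gf (kr_lists (i + 2)) + qv ^ i * (xv * gf (kr_lists (i + 3)))"
        using i1 by (simp add: gf_Un gf_Cons_image pos kr_lists_Cons_disjoint)
      with 2 show ?thesis by (simp add: kr_lists_after_2_mod_3)
    next
      assume 3: "i mod 3 = 0"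
      have "gf ((kr_lists (i + 3) \<union> Cons (i + 2) ` kr_lists (i + 4)) \<union> Cons (i + 1) ` kr_lists (i + 3))
          = gf (kr_lists (i + 3) \<union> Cons (i + 2) ` kr_lists (i + 4)) + gf (Cons (i + 1) ` kr_lists (i + 3))"
        using i1 by (intro gf_Un Un_least pos) (auto simp: kr_lists_Cons)
      also have "gf (kr_lists (i + 3) \<union> Cons (i + 2) ` kr_lists (i + 4))
          = gf (kr_lists (i + 3)) + gf (Cons (i + 2) ` kr_lists (i + 4))"
        using i1 by (intro gf_Un pos kr_lists_Cons_disjoint) auto
      finally have "gf ((kr_lists (i + 3) \<union> Cons (i + 2) ` kr_lists (i + 4)) \<union> Cons (i + 1) ` kr_lists (i + 3))
          = gf (kr_lists (i + 3)) + qv ^ (i + 2) * (xv * gf (kr_lists (i + 4)))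
            + qv ^ (i + 1) * (xv * gf (kr_lists (i + 3)))"
        using i1 by (simp add: gf_Cons_image pos)
      with 3 show ?thesis by (simp add: kr_lists_after_0_mod_3)
    qed
  qed
  finally show "gf (kr_lists i) = gf (kr_lists (i + 1)) + qv ^ i * (xv *
      (if i mod 3 = 1 then gf (kr_lists (i + 2))
       else if i mod 3 = 2 then gf (kr_lists (i + 2)) + qv ^ i * (xv * gf (kr_lists (i + 3)))
       else gf (kr_lists (i + 3)) + qv ^ (i + 2) * (xv * gf (kr_lists (i + 4)))
         + qv ^ (i + 1) * (xv * gf (kr_lists (i + 3)))))" .
qed

lemma gf_kr_lists_nth_low:
  assumes "n < i"
  shows "fps_nth (gf (kr_lists i)) n = fps_nth 1 n"
proof -
  have "fps_nth (gf (kr_lists i)) n = fps_nth (weight []) n"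
    unfolding gf_def
  proof (rule fps_nth_infsum_single)
    show "weight summable_on kr_lists i"
      using assms by (intro weight_summable kr_lists_positive) simp
    fix xs assume xs: "xs \<in> kr_lists i" "xs \<noteq> []"
    then obtain y ys where "xs = y # ys" by (cases xs) auto
    with xs have "i \<le> sum_list xs" by (auto simp: kr_lists_def)
    with assms show "fps_nth (weight xs) n = 0" by (simp add: weight_def qv_power_mult_nth)
  qed simp
  thus ?thesis by (simp add: weight_def)
qed

lemma gf_kr_lists: "1 \<le> i \<Longrightarrow> gf (kr_lists i) = dseries_family i"
  by (rule kr_recursion_unique[OF gf_kr_lists_recursion dseries_family_recursion])
     (simp_all add: gf_kr_lists_nth_low dseries_family_nth_low)

definition kr_admissible :: "nat list set" where
  "kr_admissible = {xs \<in> kr_lists 1. count_list xs 2 \<le> 1}"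

lemma count_list_kr_lists: "xs \<in> kr_lists i \<Longrightarrow> a < i \<Longrightarrow> count_list xs a = 0"
  by (auto simp: kr_lists_def count_list_0_iff)

text \<open>Of the recursive description of the partitions with parts at least \<open>1\<close>, the condition on the part
  \<open>2\<close> removes exactly those that start with a repeated \<open>2\<close>.\<close>

lemma kr_admissible_decomposition:
  "kr_admissible = (kr_lists 3 \<union> Cons 1 ` kr_lists 3) \<union> Cons 2 ` kr_lists 4"
proof -
  have "kr_lists 1 = kr_lists 2 \<union> Cons 1 ` kr_lists 3"
  proof -
    have "kr_lists 1 = kr_lists (1 + 1) \<union> Cons 1 ` kr_lists (1 + 2)"
      by (subst kr_lists_smallest_part[of 1], subst kr_lists_after_1_mod_3) simp_all
    thus ?thesis by (simp add: numeral_eq_Suc)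
  qed
  also have "kr_lists 2 = kr_lists 3 \<union> Cons 2 ` (kr_lists 4 \<union> Cons 2 ` kr_lists 5)"
  proof -
    have "kr_lists 2 = kr_lists (2 + 1) \<union> Cons 2 ` (kr_lists (2 + 2) \<union> Cons 2 ` kr_lists (2 + 3))"
      by (subst kr_lists_smallest_part[of 2], subst kr_lists_after_2_mod_3) simp_all
    thus ?thesis by simp
  qed
  finally show ?thesis
    by (auto simp: kr_admissible_def count_list_kr_lists)
qed

lemma gf_kr_admissible:
  "gf kr_admissible = gf (kr_lists 3) + qv * (xv * gf (kr_lists 3)) + qv ^ 2 * (xv * gf (kr_lists 4))"
proof -
  have pos: "kr_lists 3 \<subseteq> positive_lists" "kr_lists 4 \<subseteq> positive_lists"
    "Cons 1 ` kr_lists 3 \<subseteq> positive_lists" "Cons 2 ` kr_lists 4 \<subseteq> positive_lists"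
    by (intro kr_lists_positive Cons_image_positive; simp)+
  have "gf kr_admissible = gf (kr_lists 3 \<union> Cons 1 ` kr_lists 3) + gf (Cons 2 ` kr_lists 4)"
    unfolding kr_admissible_decomposition using pos by (intro gf_Un Un_least) (auto simp: kr_lists_Cons)
  also have "gf (kr_lists 3 \<union> Cons 1 ` kr_lists 3) = gf (kr_lists 3) + gf (Cons 1 ` kr_lists 3)"
    using pos by (intro gf_Un kr_lists_Cons_disjoint) auto
  finally show ?thesis using gf_Cons_image[OF pos(1), of 1] gf_Cons_image[OF pos(2), of 2] by simp
qed

lemma kr_partitions_eq:
  "kr_partitions n m = {xs \<in> kr_admissible. sum_list xs = n \<and> length xs = m}"
  by (auto simp: kr_partitions_def is_partition_def kr_admissible_def kr_lists_def
      kr_differences_def Suc_le_eq)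

lemma kr_series_eq_gf:
  "(\<Sum>\<^sub>\<infinity>(n, m)\<in>UNIV. of_nat (kr n m) * qv ^ n * xv ^ m) = gf kr_admissible"
proof -
  have pos: "kr_admissible \<subseteq> positive_lists"
    using kr_lists_positive[of 1] by (auto simp: kr_admissible_def)
  have nth: "fps_nth (weight xs) n = (if sum_list xs = n then fps_X ^ length xs else 0)" for xs n
    unfolding weight_def xv_power qv_power_mult_nth by simp
  have "gf kr_admissible = Abs_fps (\<lambda>n. Abs_fps (\<lambda>m. of_nat (kr n m)))"
    unfolding gf_def
  proof (intro infsumI has_sum_fpsI)
    fix n
    have B: "{xs \<in> kr_admissible. fps_nth (weight xs) n \<noteq> 0} = {xs \<in> kr_admissible. sum_list xs = n}"
      by (auto simp: nth)
    show fin: "finite {xs \<in> kr_admissible. fps_nth (weight xs) n \<noteq> 0}"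
      unfolding B by (rule finite_subset[OF _ finite_sum_list_le[OF pos, of n]]) auto
    show "fps_nth (Abs_fps (\<lambda>n. Abs_fps (\<lambda>m. of_nat (kr n m)))) n =
        (\<Sum>xs | xs \<in> kr_admissible \<and> fps_nth (weight xs) n \<noteq> 0. fps_nth (weight xs) n)"
    proof (rule fps_ext)
      fix m
      let ?A = "{xs \<in> kr_admissible. sum_list xs = n}"
      have "finite ?A" using fin unfolding B .
      have "fps_nth (\<Sum>xs\<in>?A. fps_nth (weight xs) n) m
          = (\<Sum>xs\<in>?A. if length xs = m then 1 else 0)"
        unfolding fps_sum_nth by (intro sum.cong) (auto simp: nth fps_X_power_nth)
      also have "\<dots> = of_nat (card (?A \<inter> {xs. length xs = m}))"
        using \<open>finite ?A\<close> by (simp add: sum.If_cases)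
      also have "?A \<inter> {xs. length xs = m} = kr_partitions n m"
        by (auto simp: kr_partitions_eq)
      finally show "fps_nth (fps_nth (Abs_fps (\<lambda>n. Abs_fps (\<lambda>m. of_nat (kr n m)))) n) m =
          fps_nth (\<Sum>xs | xs \<in> kr_admissible \<and> fps_nth (weight xs) n \<noteq> 0. fps_nth (weight xs) n) m"
        unfolding B by (simp add: kr_def)
    qed
  qed
  thus ?thesis using infsumI[OF kr_has_sum] by simp
qed

section \<open>The identity\<close>

lemma dseries_UNIV: "dseries UNIV a b = dseries {1..} a b + dseries {0} a b"
proof -
  have UNIV_split: "(UNIV :: nat set) \<times> (UNIV :: nat set) = UNIV \<times> {1..} \<union> UNIV \<times> {0}"
    by (auto simp: Suc_le_eq)
  show ?thesis
    unfolding dseries_def UNIV_split by (intro infsum_Un_disjoint dterm_summable) auto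
qed

text \<open>In the row \<open>n\<^sub>2 = 0\<close> the parameter \<open>b\<close> disappears. This is what allows the remainders of \<open>T(1, 4)\<close> and
  \<open>x q T(2, 4)\<close> to be combined by the relation for \<open>T(0, 1)\<close>.\<close>

lemma dseries_row_0: "dseries {0} a b = (\<Sum>\<^sub>\<infinity>n1\<in>UNIV. qv ^ (n1^2 + a * n1) * xv ^ n1 / qpoch qv qv n1)"
proof -
  have row: "(UNIV :: nat set) \<times> {0 :: nat} = (\<lambda>n1. (n1, 0)) ` UNIV" by auto
  have "dseries {0} a b = infsum ((\<lambda>(n1, n2). dterm a b n1 n2) \<circ> (\<lambda>n1. (n1, 0))) UNIV"
    unfolding dseries_def row by (intro infsum_reindex) (auto simp: inj_on_def)
  also have "(\<lambda>(n1, n2). dterm a b n1 n2) \<circ> (\<lambda>n1. (n1, 0))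
      = (\<lambda>n1. qv ^ (n1^2 + a * n1) * xv ^ n1 / qpoch qv qv n1)"
    by (auto simp: dterm_def qpoch_def)
  finally show ?thesis .
qed

theorem theorem13:
  shows "(\<Sum>\<^sub>\<infinity>(n, m)\<in>UNIV. of_nat (kr n m) * qv ^ n * xv ^ m)
    = (\<Sum>\<^sub>\<infinity>(n1, n2)\<in>UNIV \<times> {1..}.
         qv ^ (3 * n2^2 + 4 * n2 + n1^2 + n1 + 3 * n1 * n2) * xv ^ (2 * n2 + n1)
           / (qpoch qv qv n1 * qpoch (qv^3) (qv^3) n2))
    + (\<Sum>\<^sub>\<infinity>(n1, n2)\<in>UNIV \<times> {1..}.
         qv ^ (3 * n2^2 + 4 * n2 + (n1 + 1)^2 + 3 * n1 * n2) * xv ^ (2 * n2 + n1 + 1)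
           / (qpoch qv qv n1 * qpoch (qv^3) (qv^3) n2))
    + (\<Sum>\<^sub>\<infinity>n1\<in>UNIV. qv ^ (n1^2) * xv ^ n1 / qpoch qv qv n1)"
    (is "?L = ?S1 + ?S2 + ?S3")
proof -
  have fam: "dseries_family 3 = dseries UNIV 2 4" "dseries_family 4 = dseries UNIV 3 7"
    by (simp_all add: dseries_family_def)
  have "?L = dseries UNIV 2 4 + qv * xv * dseries UNIV 2 4 + qv ^ 2 * xv * dseries UNIV 3 7"
    unfolding kr_series_eq_gf by (simp add: gf_kr_admissible gf_kr_lists fam mult.assoc)
  also have "\<dots> = dseries UNIV 1 4 + qv * xv * dseries UNIV 2 4"
    using dseries_shift_left[of UNIV 1 4] by (simp add: algebra_simps numeral_eq_Suc)
  also have "\<dots> = dseries {1..} 1 4 + qv * xv * dseries {1..} 2 4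
      + (dseries {0} 1 4 + qv * xv * dseries {0} 2 4)"
    unfolding dseries_UNIV by (simp add: algebra_simps)
  also have "dseries {0} 1 4 + qv * xv * dseries {0} 2 4 = dseries {0} 0 1"
  proof -
    have "dseries {0} 1 4 = dseries {0} 1 1" by (simp only: dseries_row_0)
    thus ?thesis using dseries_shift_left[of "{0}" 0 1] by (simp add: numeral_2_eq_2)
  qed
  also have "dseries {0} 0 1 = ?S3" by (simp add: dseries_row_0)
  also have "dseries {1..} 1 4 = ?S1"
    unfolding dseries_def dterm_def by (simp add: ac_simps)
  also have "qv * xv * dseries {1..} 2 4 = ?S2"
  proof -
    have "?S2 = (\<Sum>\<^sub>\<infinity>(n1, n2)\<in>UNIV \<times> {1..}. qv * xv * dterm 2 4 n1 n2)"
    proof (intro infsum_cong, clarify)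
      fix n1 n2 :: nat
      have e: "3 * n2^2 + 4 * n2 + (n1 + 1)^2 + 3 * n1 * n2 = 1 + (n1^2 + 3 * n1 * n2 + 3 * n2^2 + 2 * n1 + 4 * n2)"
        "2 * n2 + n1 + 1 = 1 + (n1 + 2 * n2)"
        by (simp_all add: power2_eq_square algebra_simps)
      show "qv ^ (3 * n2^2 + 4 * n2 + (n1 + 1)^2 + 3 * n1 * n2) * xv ^ (2 * n2 + n1 + 1)
           / (qpoch qv qv n1 * qpoch (qv^3) (qv^3) n2) = qv * xv * dterm 2 4 n1 n2"
        unfolding e dterm_def power_add[of _ 1] fps_divide_mult_cancel(1)[OF denominator_nth_0]
        by (simp add: mult_ac)
    qed
    also have "\<dots> = qv * xv * dseries {1..} 2 4"
      unfolding dseries_def case_prod_unfold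
      by (rule infsum_cmult_right) (use dterm_summable in \<open>simp add: case_prod_unfold\<close>)
    finally show ?thesis by simp
  qed
  finally show ?thesis .
qed

end
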